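(* (1) Any Krull domain is Clifford $t$-regular. (2) A domain $R$ is a UFD if and only if $R$ is Krull and Boole $t$-regular.
   Context: All rings are integral domains. Let $R$ be a domain with quotient field $K$. For fractional ideals $I,J$ of $R$, $(I:J)=\{x\in K : xJ\subseteq I\}$. For a nonzero fractional ideal $I$, put $I^{-1}=(R:I)$, $I_v=(I^{-1})^{-1}$, and $I_t=\bigcup J_v$, where $J$ ranges over the nonzero finitely generated fractional ideals contained in $I$. $I$ is a $t$-ideal if it is nonzero and $I_t=I$. The fractional $t$-ideals form a commutative semigroup $F_t(R)$ under $(I,J)\mapsto (IJ)_t$, and $\mathcal S_t(R)=F_t(R)/P(R)$ is the quotient by the group $P(R)$ of nonzero principal fractional ideals (so the classes of $I$ and $J$ coincide iff $I=cJ$ for some $0\neq c\in K$). A commutative semigroup $S$ is Clifford if for every $x\in S$ there is $a\in S$ with $x^2a=x$, and Boolean if $x^2=x$ for every $x\in S$. $R$ is Clifford (resp., Boole) $t$-regular if $\mathcal S_t(R)$ is Clifford (resp., Boolean). *)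

theory Defs
  imports
    "HOL-Computational_Algebra.Polynomial_Factorial"
    "HOL-Algebra.Coset"
    "Berlekamp_Zassenhaus.Unique_Factorization"
begin

text \<open>
  The domain \<open>R\<close> is a type \<open>'a :: idom\<close>, its quotient field \<open>K\<close> is \<open>'a fract\<close>, and
  \<open>R\<close> sits in \<open>K\<close> as \<open>range to_fract\<close>.
\<close>

interpretation fract_module: Modules.module "\<lambda>(r :: 'a :: idom) (x :: 'a fract). to_fract r * x"
  by unfold_locales (simp_all add: algebra_simps)

definition fractional_ideal :: "'a :: idom fract set \<Rightarrow> bool" where
  "fractional_ideal I \<longleftrightarrow>
     fract_module.subspace I \<and> (\<exists>d. d \<noteq> 0 \<and> (\<forall>x\<in>I. to_fract d * x \<in> range to_fract))"

definition finitely_generated :: "'a :: idom fract set \<Rightarrow> bool" where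
  "finitely_generated I \<longleftrightarrow> (\<exists>S. finite S \<and> I = fract_module.span S)"

definition ideal_product :: "'a :: idom fract set \<Rightarrow> 'a fract set \<Rightarrow> 'a fract set" where
  "ideal_product I J = fract_module.span {x * y | x y. x \<in> I \<and> y \<in> J}"

definition ideal_colon :: "'a :: idom fract set \<Rightarrow> 'a fract set \<Rightarrow> 'a fract set" where
  "ideal_colon I J = {x. \<forall>y\<in>J. x * y \<in> I}"

definition ideal_inverse :: "'a :: idom fract set \<Rightarrow> 'a fract set" where
  "ideal_inverse I = ideal_colon (range to_fract) I"

definition v_closure :: "'a :: idom fract set \<Rightarrow> 'a fract set" where
  "v_closure I = ideal_inverse (ideal_inverse I)"

definition t_closure :: "'a :: idom fract set \<Rightarrow> 'a fract set" where
  "t_closure I =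
     \<Union> {v_closure J | J. fractional_ideal J \<and> J \<noteq> {0} \<and> finitely_generated J \<and> J \<subseteq> I}"

definition fractional_t_ideal :: "'a :: idom fract set \<Rightarrow> bool" where
  "fractional_t_ideal I \<longleftrightarrow> fractional_ideal I \<and> I \<noteq> {0} \<and> t_closure I = I"

definition t_ideal_semigroup :: "'a :: idom itself \<Rightarrow> 'a fract set monoid" where
  "t_ideal_semigroup _ =
     \<lparr>carrier = {I. fractional_t_ideal I},
      mult = (\<lambda>I J. t_closure (ideal_product I J)),
      one = range to_fract\<rparr>"

definition principal_ideals :: "'a :: idom itself \<Rightarrow> 'a fract set set" where
  "principal_ideals _ = {fract_module.span {c} | c. c \<noteq> 0}"

text \<open>
  \<open>(Mod)\<close> is defined for arbitrary monoids: the elements are the cosets of the subgroup of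
  principal ideals, so the class of a \<open>t\<close>-ideal \<open>I\<close> is the set of all \<open>c I\<close> with \<open>c \<noteq> 0\<close>
  (because \<open>(c I)\<^sub>t = c I\<^sub>t = c I\<close>), and two classes are multiplied elementwise.
\<close>

definition t_class_semigroup :: "'a :: idom itself \<Rightarrow> 'a fract set set monoid" where
  "t_class_semigroup R = t_ideal_semigroup R Mod principal_ideals R"

text \<open>The next two predicates are meant for commutative semigroups; the unit is not used.\<close>

definition clifford :: "('s, 'm) monoid_scheme \<Rightarrow> bool" where
  "clifford S \<longleftrightarrow>
     (\<forall>x\<in>carrier S. \<exists>a\<in>carrier S. (x \<otimes>\<^bsub>S\<^esub> x) \<otimes>\<^bsub>S\<^esub> a = x)"

definition boolean :: "('s, 'm) monoid_scheme \<Rightarrow> bool" where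
  "boolean S \<longleftrightarrow> (\<forall>x\<in>carrier S. x \<otimes>\<^bsub>S\<^esub> x = x)"

definition clifford_t_regular :: "'a :: idom itself \<Rightarrow> bool" where
  "clifford_t_regular R \<longleftrightarrow> clifford (t_class_semigroup R)"

definition boole_t_regular :: "'a :: idom itself \<Rightarrow> bool" where
  "boole_t_regular R \<longleftrightarrow> boolean (t_class_semigroup R)"

text \<open>
  Normalized discrete rank-one valuations. The value at \<open>0\<close> (classically \<open>\<infinity>\<close>) is left
  arbitrary and never used.
\<close>

definition discrete_valuation :: "('k :: field \<Rightarrow> int) \<Rightarrow> bool" where
  "discrete_valuation v \<longleftrightarrow>
     (\<forall>x y. x \<noteq> 0 \<longrightarrow> y \<noteq> 0 \<longrightarrow> v (x * y) = v x + v y) \<and>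
     (\<forall>x y. x \<noteq> 0 \<longrightarrow> y \<noteq> 0 \<longrightarrow> x + y \<noteq> 0 \<longrightarrow> min (v x) (v y) \<le> v (x + y)) \<and>
     v ` (UNIV - {0}) = UNIV"

text \<open>
  A Krull domain is the intersection of a family of discrete valuation rings of its quotient
  field, with finite character. The family may be empty, so fields are Krull domains.
\<close>

definition krull_domain :: "'a :: idom itself \<Rightarrow> bool" where
  "krull_domain _ \<longleftrightarrow>
     (\<exists>V :: ('a fract \<Rightarrow> int) set.
        (\<forall>v\<in>V. discrete_valuation v) \<and>
        range to_fract = {x. x = 0 \<or> (\<forall>v\<in>V. 0 \<le> v x)} \<and>
        (\<forall>x. x \<noteq> 0 \<longrightarrow> finite {v \<in> V. v x \<noteq> 0}))"

text \<open>
  \<open>class.ufd\<close> is the predicate underlying the type class \<open>ufd\<close>: every nonzero nonunit is a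
  product of irreducible elements, uniquely up to order and associates.
\<close>

definition factorial_ring :: "'a :: idom itself \<Rightarrow> bool" where
  "factorial_ring _ \<longleftrightarrow> class.ufd ((*) :: 'a \<Rightarrow> 'a \<Rightarrow> 'a) 1 (+) 0 (-) uminus"

end

theory Submission
  imports Defs
begin

text \<open>
  Write \<open>R\<close> for the domain and \<open>K\<close> for its quotient field. Everything about Krull domains rests on
  one observation: if \<open>V\<close> is a defining family of discrete valuations and \<open>I\<close> is a nonzero fractional
  ideal, then a nonzero \<open>x\<close> lies in the inverse of \<open>I\<close> iff \<open>v x \<ge> - min v(I)\<close> for all \<open>v \<in> V\<close>. By finite
  character the minima \<open>min v(I)\<close> are already attained on a finite subset of \<open>I\<close>
  (\<open>finite_subset_same_inverse\<close>), so the \<open>t\<close>-closure is the \<open>v\<close>-closure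
  (\<open>t_closure_eq_v_closure\<close>). The minima also give \<open>(I : I) = R\<close> (\<open>ideal_colon_self\<close>).

  Since the inverse of a product is a colon, \<open>(R : I J) = ((R : I) : J)\<close>, the \<open>v\<close>-product is
  associative, and the inverse of \<open>I\<^sup>-\<^sup>1 I\<close> is \<open>(I\<^sup>-\<^sup>1 : I\<^sup>-\<^sup>1) = R\<close>. Hence the fractional \<open>t\<close>-ideals of a
  Krull domain form an abelian group (\<open>comm_group_t_ideals\<close>), the principal ideals form a subgroup,
  and the class semigroup is a quotient group. A group is a Clifford semigroup, which is the first
  claim. A group is Boolean only if it is trivial, so a Krull domain is Boole \<open>t\<close>-regular iff the
  \<open>v\<close>-closure of every nonzero fractional ideal is principal (\<open>boole_t_regular_iff\<close>).

  It remains to show that a domain is factorial iff it is Krull with all these closures principal.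
  A factorial domain is Krull by its prime valuations (\<open>krull_domain_if_factorial_ring\<close>), and in it
  \<open>I\<^sup>-\<^sup>1\<close> is generated by the reciprocal of a greatest common divisor of \<open>I\<close>
  (\<open>factorial_ring_v_closure_principal\<close>). Conversely, in a Krull domain the sum of all valuations of
  an element bounds the length of its factorizations, so irreducible factorizations exist; and if the
  closure of the ideal \<open>(p, b)\<close> is principal then its generator is a greatest common divisor that
  behaves well under multiplication, which makes every irreducible element prime
  (\<open>irreducible_imp_prime_elem_if_v_closure_principal\<close>).
\<close>

text \<open>
  Contracting \<open>to_fract a * (to_fract b * x)\<close> to \<open>to_fract (a * b) * x\<close> runs against
  \<open>to_fract_mult\<close>, which expands it again; the simplifier loops when both are active.
\<close>
declare fract_module.scale_scale [simp del]

section \<open>Groups as Clifford and Boolean semigroups\<close>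

lemma clifford_group:
  assumes "group G"
  shows "clifford G"
proof -
  interpret group G by fact
  show ?thesis
    unfolding clifford_def
  proof
    fix x assume "x \<in> carrier G"
    then show "\<exists>a\<in>carrier G. (x \<otimes>\<^bsub>G\<^esub> x) \<otimes>\<^bsub>G\<^esub> a = x"
      by (intro bexI[of _ "inv\<^bsub>G\<^esub> x"]) (simp_all add: m_assoc)
  qed
qed

lemma boolean_group_iff:
  assumes "group G"
  shows "boolean G \<longleftrightarrow> carrier G = {\<one>\<^bsub>G\<^esub>}"
proof -
  interpret group G by fact
  show ?thesis
    unfolding boolean_def using l_cancel_one by fastforce
qed

text \<open>
  A Boolean quotient group is trivial, because the unit is the only idempotent of a group.
\<close>
lemma boolean_quotient_iff:
  assumes "N \<lhd> G"
  shows "boolean (G Mod N) \<longleftrightarrow> carrier G \<subseteq> N"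
proof -
  interpret normal N G by fact
  have coset: "N #>\<^bsub>G\<^esub> x = N \<longleftrightarrow> x \<in> N" if "x \<in> carrier G" for x
    using that coset_join1 coset_join2 subset is_subgroup by blast
  show ?thesis
    unfolding boolean_group_iff[OF factorgroup_is_group] carrier_FactGroup one_FactGroup
    using coset one_closed by (auto simp: image_iff)
qed


section \<open>Fractional ideals, inverses and divisorial closure\<close>

lemma range_to_fract_add:
  "x \<in> range to_fract \<Longrightarrow> y \<in> range to_fract \<Longrightarrow> x + y \<in> range to_fract"
  by (elim imageE) (simp flip: to_fract_add)

lemma range_to_fract_mult:
  "x \<in> range to_fract \<Longrightarrow> y \<in> range to_fract \<Longrightarrow> x * y \<in> range to_fract"
  by (elim imageE) (simp flip: to_fract_mult)

lemma zero_in_range_to_fract [simp]: "0 \<in> range to_fract"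
  by (metis rangeI to_fract_0)

lemma span_singleton_eq: "fract_module.span {c} = (\<lambda>r. to_fract r * c) ` UNIV"
  by (rule fract_module.span_singleton)

lemma subspace_range_to_fract: "fract_module.subspace (range to_fract)"
  by (intro fract_module.subspaceI) (auto intro: range_to_fract_add range_to_fract_mult)

lemma span_one: "fract_module.span {1} = range to_fract"
  by (auto simp: span_singleton_eq)

lemma mem_ideal_inverse: "x \<in> ideal_inverse I \<longleftrightarrow> (\<forall>y\<in>I. x * y \<in> range to_fract)"
  by (simp add: ideal_inverse_def ideal_colon_def)

lemma subspace_ideal_colon:
  assumes "fract_module.subspace I"
  shows "fract_module.subspace (ideal_colon I J)"
  using assms unfolding fract_module.subspace_def ideal_colon_def
  by (auto simp: distrib_right mult.assoc)

lemma ideal_colon_span: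
  assumes "fract_module.subspace I"
  shows "ideal_colon I (fract_module.span S) = ideal_colon I S"
proof
  show "ideal_colon I (fract_module.span S) \<subseteq> ideal_colon I S"
    unfolding ideal_colon_def using fract_module.span_base by blast
  show "ideal_colon I S \<subseteq> ideal_colon I (fract_module.span S)"
  proof
    fix x assume x: "x \<in> ideal_colon I S"
    have "fract_module.subspace {y. x * y \<in> I}"
    proof (rule fract_module.subspaceI)
      fix r y assume "y \<in> {y. x * y \<in> I}"
      then have "to_fract r * (x * y) \<in> I"
        using fract_module.subspace_scale[OF assms] by blast
      then show "to_fract r * y \<in> {y. x * y \<in> I}"
        by (simp only: mem_Collect_eq mult.left_commute)
    qed (use assms in \<open>simp_all add: distrib_left fract_module.subspace_0 fract_module.subspace_add\<close>)
    moreover have "S \<subseteq> {y. x * y \<in> I}"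
      using x by (auto simp: ideal_colon_def)
    ultimately have "fract_module.span S \<subseteq> {y. x * y \<in> I}"
      by (intro fract_module.span_minimal)
    then show "x \<in> ideal_colon I (fract_module.span S)"
      by (auto simp: ideal_colon_def)
  qed
qed

lemma ideal_inverse_span: "ideal_inverse (fract_module.span S) = ideal_inverse S"
  unfolding ideal_inverse_def by (rule ideal_colon_span[OF subspace_range_to_fract])

lemma subspace_ideal_inverse: "fract_module.subspace (ideal_inverse I)"
  unfolding ideal_inverse_def by (rule subspace_ideal_colon[OF subspace_range_to_fract])

lemma ideal_inverse_antimono: "I \<subseteq> J \<Longrightarrow> ideal_inverse J \<subseteq> ideal_inverse I"
  unfolding mem_ideal_inverse subset_iff by blast

lemma subset_v_closure: "I \<subseteq> v_closure I"
proof
  fix x assume "x \<in> I"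
  then show "x \<in> v_closure I"
    by (auto simp: v_closure_def mem_ideal_inverse mult.commute[of x])
qed

lemma v_closure_times_inverse:
  "x \<in> v_closure I \<Longrightarrow> y \<in> ideal_inverse I \<Longrightarrow> x * y \<in> range to_fract"
  by (simp add: v_closure_def mem_ideal_inverse[of x])

lemma v_closure_mono: "I \<subseteq> J \<Longrightarrow> v_closure I \<subseteq> v_closure J"
  unfolding v_closure_def by (intro ideal_inverse_antimono)

lemma ideal_inverse_v_closure: "ideal_inverse (v_closure I) = ideal_inverse I"
  using ideal_inverse_antimono[OF subset_v_closure[of I]] subset_v_closure[of "ideal_inverse I"]
  unfolding v_closure_def by blast

lemma mem_ideal_inverse_product:
  fixes x :: "'a :: idom fract"
  shows "x \<in> ideal_inverse (ideal_product I J) \<longleftrightarrow> (\<forall>b\<in>J. \<forall>a\<in>I. x * b * a \<in> range to_fract)"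
proof -
  have *: "x * (a * b) = x * b * a" for a b
    by (simp add: mult_ac)
  have "x \<in> ideal_inverse (ideal_product I J) \<longleftrightarrow> (\<forall>b\<in>J. \<forall>a\<in>I. x * (a * b) \<in> range to_fract)"
    unfolding ideal_product_def ideal_inverse_span mem_ideal_inverse by blast
  then show ?thesis
    unfolding * .
qed

text \<open>
  This turns products into iterated colons. The behaviour of the \<open>v\<close>-closure on products follows from
  it, since the closure of an ideal is determined by the inverse.
\<close>
lemma ideal_inverse_product:
  "ideal_inverse (ideal_product I J) = ideal_colon (ideal_inverse I) J"
  unfolding set_eq_iff mem_ideal_inverse_product
  unfolding ideal_colon_def mem_Collect_eq mem_ideal_inverse
  by blast

lemma ideal_product_commute:
  fixes I J :: "'a :: idom fract set"
  shows "ideal_product I J = ideal_product J I"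
proof -
  have "{x * y | x y. x \<in> I \<and> y \<in> J} = {y * x | x y. x \<in> I \<and> y \<in> J}"
    by (simp add: mult.commute)
  also have "\<dots> = {y * x | y x. y \<in> J \<and> x \<in> I}"
    by blast
  finally show ?thesis
    by (simp add: ideal_product_def)
qed

lemma v_closure_product_v_closure_left:
  "v_closure (ideal_product (v_closure I) J) = v_closure (ideal_product I J)"
  unfolding v_closure_def[of "ideal_product _ _"] ideal_inverse_product ideal_inverse_v_closure ..

text \<open>
  Both triple products have the inverse \<open>{x. x I J L \<subseteq> R}\<close>, and inner closures do not change an
  inverse.
\<close>
lemma v_closure_product_assoc:
  fixes I J L :: "'a :: idom fract set"
  shows "v_closure (ideal_product (v_closure (ideal_product I J)) L) =
   v_closure (ideal_product I (v_closure (ideal_product J L)))"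
proof -
  have *: "(\<forall>c\<in>L. \<forall>b\<in>J. \<forall>a\<in>I. x * c * b * a \<in> range to_fract) \<longleftrightarrow>
           (\<forall>a\<in>I. \<forall>c\<in>L. \<forall>b\<in>J. x * a * c * b \<in> range to_fract)" for x
  proof -
    have "(\<forall>c\<in>L. \<forall>b\<in>J. \<forall>a\<in>I. x * c * b * a \<in> range to_fract) \<longleftrightarrow>
          (\<forall>a\<in>I. \<forall>c\<in>L. \<forall>b\<in>J. x * c * b * a \<in> range to_fract)"
      by blast
    also have "\<dots> \<longleftrightarrow> (\<forall>a\<in>I. \<forall>c\<in>L. \<forall>b\<in>J. x * a * c * b \<in> range to_fract)"
      by (intro ball_cong refl) (simp add: mult_ac)
    finally show ?thesis .
  qed
  have "ideal_inverse (ideal_product (ideal_product I J) L) =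
        {x. \<forall>c\<in>L. \<forall>b\<in>J. \<forall>a\<in>I. x * c * b * a \<in> range to_fract}"
    unfolding ideal_inverse_product by (simp add: ideal_colon_def mem_ideal_inverse)
  also have "\<dots> = {x. \<forall>a\<in>I. \<forall>c\<in>L. \<forall>b\<in>J. x * a * c * b \<in> range to_fract}"
    by (intro Collect_cong *)
  also have "\<dots> = ideal_inverse (ideal_product I (ideal_product J L))"
    unfolding ideal_product_commute[of I] ideal_inverse_product
    by (simp add: ideal_colon_def mem_ideal_inverse)
  finally have "v_closure (ideal_product (ideal_product I J) L) =
                v_closure (ideal_product I (ideal_product J L))"
    by (simp add: v_closure_def)
  then show ?thesis
    by (metis v_closure_product_v_closure_left ideal_product_commute)
qed

text \<open>
  A denominator is allowed to be any nonzero element of the quotient field. In this form the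
  condition is symmetric in \<open>I\<close> and its inverse, so that closure under inversion is immediate.
\<close>
definition nonzero_fractional_ideal :: "'a :: idom fract set \<Rightarrow> bool" where
  "nonzero_fractional_ideal I \<longleftrightarrow>
     fract_module.subspace I \<and> (\<exists>x\<in>I. x \<noteq> 0) \<and> (\<exists>c\<in>ideal_inverse I. c \<noteq> 0)"

lemma fract_denominator:
  fixes x :: "'a :: idom fract"
  obtains a b where "b \<noteq> 0" "x * to_fract b = to_fract a"
proof (cases x)
  case (Fract a b)
  with that[of b a] show ?thesis
    by (simp add: Fract_conv_to_fract)
qed

lemma nonzero_fractional_ideal_iff:
  "nonzero_fractional_ideal I \<longleftrightarrow> fractional_ideal I \<and> I \<noteq> {0}"
proof
  assume "nonzero_fractional_ideal I"
  then obtain x c where I: "fract_module.subspace I" and x: "x \<in> I" "x \<noteq> 0"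
    and c: "\<forall>y\<in>I. c * y \<in> range to_fract" "c \<noteq> 0"
    by (auto simp: nonzero_fractional_ideal_def mem_ideal_inverse)
  obtain a b where ab: "b \<noteq> 0" "c * to_fract b = to_fract a"
    by (rule fract_denominator)
  have "a \<noteq> 0"
    using ab c(2) by auto
  moreover have "to_fract a * y \<in> range to_fract" if "y \<in> I" for y
  proof -
    have "to_fract a * y = to_fract b * (c * y)"
      by (simp flip: ab(2) add: mult_ac)
    also have "\<dots> \<in> range to_fract"
      using c(1) that range_to_fract_mult by blast
    finally show ?thesis .
  qed
  ultimately show "fractional_ideal I \<and> I \<noteq> {0}"
    using I x by (auto simp: fractional_ideal_def)
next
  assume *: "fractional_ideal I \<and> I \<noteq> {0}"
  then obtain d where I: "fract_module.subspace I" and d: "to_fract d \<noteq> 0" "to_fract d \<in> ideal_inverse I"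
    by (auto simp: fractional_ideal_def mem_ideal_inverse)
  from * I have "\<exists>x\<in>I. x \<noteq> 0"
    using fract_module.subspace_0 by fastforce
  with I d show "nonzero_fractional_ideal I"
    unfolding nonzero_fractional_ideal_def by blast
qed

lemma nonzero_fractional_ideal_inverse:
  assumes "nonzero_fractional_ideal I"
  shows "nonzero_fractional_ideal (ideal_inverse I)"
  using assms subset_v_closure[of I] subspace_ideal_inverse[of I]
  unfolding nonzero_fractional_ideal_def v_closure_def by blast

lemma nonzero_fractional_ideal_v_closure:
  "nonzero_fractional_ideal I \<Longrightarrow> nonzero_fractional_ideal (v_closure I)"
  unfolding v_closure_def by (intro nonzero_fractional_ideal_inverse)

lemma nonzero_fractional_ideal_product:
  assumes "nonzero_fractional_ideal I" "nonzero_fractional_ideal J"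
  shows "nonzero_fractional_ideal (ideal_product I J)"
proof -
  from assms obtain x y c d where x: "x \<in> I" "x \<noteq> 0" and y: "y \<in> J" "y \<noteq> 0"
    and c: "c \<in> ideal_inverse I" "c \<noteq> 0" and d: "d \<in> ideal_inverse J" "d \<noteq> 0"
    by (auto simp: nonzero_fractional_ideal_def)
  have "x * y \<in> ideal_product I J"
    unfolding ideal_product_def using x y by (intro fract_module.span_base) blast
  moreover have "c * d \<in> ideal_inverse (ideal_product I J)"
    unfolding mem_ideal_inverse_product
  proof (intro ballI)
    fix b a assume "b \<in> J" "a \<in> I"
    then have "(c * a) * (d * b) \<in> range to_fract"
      using c d unfolding mem_ideal_inverse by (intro range_to_fract_mult[of "c * a" "d * b"]) blast+
    then show "c * d * b * a \<in> range to_fract"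
      by (simp add: mult_ac)
  qed
  moreover have "fract_module.subspace (ideal_product I J)"
    unfolding ideal_product_def by simp
  ultimately show ?thesis
    using x y c d unfolding nonzero_fractional_ideal_def by (metis mult_eq_0_iff)
qed

lemma t_closure_subset_v_closure: "t_closure I \<subseteq> v_closure I"
  unfolding t_closure_def using v_closure_mono by blast

text \<open>
  The finite set \<open>S\<close> generates one of the ideals \<open>J\<close> in the union that defines the \<open>t\<close>-closure, and
  \<open>J\<close> has the same \<open>v\<close>-closure as \<open>I\<close>; the other inclusion is the monotonicity of the \<open>v\<close>-closure.
\<close>
lemma t_closure_eq_v_closureI:
  assumes I: "nonzero_fractional_ideal I"
    and S: "finite S" "S \<subseteq> I" "x \<in> S" "x \<noteq> 0" "ideal_inverse S = ideal_inverse I"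
  shows "t_closure I = v_closure I"
proof
  let ?J = "fract_module.span S"
  have "?J \<subseteq> I"
    using S(2) I by (intro fract_module.span_minimal) (auto simp: nonzero_fractional_ideal_def)
  moreover have "nonzero_fractional_ideal ?J"
    using I S fract_module.span_base[of x S] unfolding nonzero_fractional_ideal_def
    by (auto simp: ideal_inverse_span)
  moreover have "v_closure ?J = v_closure I"
    by (simp add: v_closure_def ideal_inverse_span S(5))
  ultimately show "v_closure I \<subseteq> t_closure I"
    unfolding t_closure_def finitely_generated_def nonzero_fractional_ideal_iff
    using S(1) by blast
qed (rule t_closure_subset_v_closure)

lemma ideal_inverse_principal:
  assumes "c \<noteq> 0"
  shows "ideal_inverse (fract_module.span {c}) = fract_module.span {inverse c}"
proof -
  have "x * c \<in> range to_fract \<longleftrightarrow> x \<in> fract_module.span {inverse c}" for x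
  proof
    assume "x * c \<in> range to_fract"
    then obtain r where "x * c = to_fract r" by auto
    then have "x = to_fract r * inverse c"
      using assms by (simp add: field_simps)
    then show "x \<in> fract_module.span {inverse c}"
      by (auto simp: span_singleton_eq)
  qed (use assms in \<open>auto simp: span_singleton_eq mult.assoc\<close>)
  then show ?thesis
    by (auto simp: ideal_inverse_span mem_ideal_inverse)
qed

lemma v_closure_principal:
  "c \<noteq> 0 \<Longrightarrow> v_closure (fract_module.span {c}) = fract_module.span {c}"
  by (simp add: v_closure_def ideal_inverse_principal)

lemma nonzero_fractional_ideal_principal:
  assumes "c \<noteq> 0"
  shows "nonzero_fractional_ideal (fract_module.span {c})"
  unfolding nonzero_fractional_ideal_def ideal_inverse_principal[OF assms]
  using assms fract_module.span_base[OF singletonI] nonzero_imp_inverse_nonzero[OF assms]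
    fract_module.subspace_span by blast

lemma v_closure_product_principal:
  assumes "c \<noteq> 0" "d \<noteq> 0"
  shows "v_closure (ideal_product (fract_module.span {c}) (fract_module.span {d})) =
         fract_module.span {c * d}"
proof -
  have "ideal_inverse (ideal_product (fract_module.span {c}) (fract_module.span {d})) =
        ideal_inverse (fract_module.span {c * d})"
    unfolding ideal_inverse_product ideal_colon_span[OF subspace_ideal_inverse] ideal_inverse_span
    by (auto simp: ideal_colon_def mem_ideal_inverse mult.assoc mult.commute[of d c])
  then show ?thesis
    using v_closure_principal[of "c * d"] assms by (simp add: v_closure_def)
qed

lemma v_closure_product_one:
  "v_closure (ideal_product (range to_fract) I) = v_closure I"
proof -
  have "ideal_inverse (ideal_product (range to_fract) I) = ideal_inverse I"
    unfolding span_one[symmetric] ideal_product_commute[of _ I] ideal_inverse_product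
      ideal_colon_span[OF subspace_ideal_inverse]
    by (simp add: ideal_colon_def)
  then show ?thesis by (simp add: v_closure_def)
qed


section \<open>Krull domains\<close>

locale krull_valuations =
  fixes V :: "('a :: idom fract \<Rightarrow> int) set"
  assumes discrete: "v \<in> V \<Longrightarrow> discrete_valuation v"
    and range_eq: "range (to_fract :: 'a \<Rightarrow> _) = {x. x = 0 \<or> (\<forall>v\<in>V. 0 \<le> v x)}"
    and finite_character: "x \<noteq> 0 \<Longrightarrow> finite {v \<in> V. v x \<noteq> 0}"

lemma krull_domain_iff:
  "krull_domain TYPE('a :: idom) \<longleftrightarrow> (\<exists>V :: ('a fract \<Rightarrow> int) set. krull_valuations V)"
  unfolding krull_domain_def krull_valuations_def by auto

context krull_valuations
begin

lemma valuation_mult: "v \<in> V \<Longrightarrow> x \<noteq> 0 \<Longrightarrow> y \<noteq> 0 \<Longrightarrow> v (x * y) = v x + v y"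
  using discrete by (auto simp: discrete_valuation_def)

lemma integral_iff: "x \<noteq> 0 \<Longrightarrow> x \<in> range to_fract \<longleftrightarrow> (\<forall>v\<in>V. 0 \<le> v x)"
  by (simp add: range_eq)

text \<open>
  A denominator \<open>c\<close> of \<open>I\<close> bounds the values on \<open>I\<close> from below by \<open>- v c\<close>, and the values are integers.
\<close>
lemma valuation_attains_minimum:
  assumes "nonzero_fractional_ideal (I :: 'a fract set)" "v \<in> V"
  shows "\<exists>y\<in>I. y \<noteq> 0 \<and> (\<forall>z\<in>I. z \<noteq> 0 \<longrightarrow> v y \<le> v z)"
proof -
  from assms obtain x c where x: "x \<in> I" "x \<noteq> 0"
    and c: "\<forall>y\<in>I. c * y \<in> range to_fract" "c \<noteq> 0"
    by (auto simp: nonzero_fractional_ideal_def mem_ideal_inverse)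
  have bound: "0 \<le> v c + v z" if "z \<in> I" "z \<noteq> 0" for z
    using that c assms(2) integral_iff[of "c * z"] valuation_mult[of v c z] by auto
  obtain y where y: "y \<in> I \<and> y \<noteq> 0"
    "\<forall>z. z \<in> I \<and> z \<noteq> 0 \<longrightarrow> nat (v c + v y) \<le> nat (v c + v z)"
    using ex_has_least_nat[of "\<lambda>z. z \<in> I \<and> z \<noteq> 0" x "\<lambda>z. nat (v c + v z)"] x by blast
  then show ?thesis
    using bound by (intro bexI[of _ y]) (auto simp: nat_le_eq_zle)
qed

text \<open>
  Take some nonzero \<open>y \<in> I\<close> and a denominator \<open>c\<close> of \<open>I\<close>. If \<open>v y = v c = 0\<close>, then \<open>y\<close> attains the minimum
  of \<open>v\<close> on \<open>I\<close>, since all values on \<open>I\<close> are at least \<open>- v c\<close>. By finite character only finitely many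
  \<open>v\<close> remain, and one minimizer is added to the set for each of them.
\<close>
lemma finite_subset_same_inverse:
  assumes I: "nonzero_fractional_ideal (I :: 'a fract set)"
  shows "\<exists>S. finite S \<and> S \<subseteq> I \<and> (\<exists>x\<in>S. x \<noteq> 0) \<and> ideal_inverse S = ideal_inverse I"
proof -
  from I obtain y c where y: "y \<in> I" "y \<noteq> 0"
    and c: "\<forall>z\<in>I. c * z \<in> range to_fract" "c \<noteq> 0"
    by (auto simp: nonzero_fractional_ideal_def mem_ideal_inverse)
  obtain m where m: "\<And>v. v \<in> V \<Longrightarrow> m v \<in> I \<and> m v \<noteq> 0 \<and> (\<forall>z\<in>I. z \<noteq> 0 \<longrightarrow> v (m v) \<le> v z)"
    using valuation_attains_minimum[OF I] by metis
  define B where "B = {v \<in> V. v y \<noteq> 0} \<union> {v \<in> V. v c \<noteq> 0}"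
  define S where "S = insert y (m ` B)"
  have "finite S"
    unfolding S_def B_def using finite_character y(2) c(2) by simp
  moreover have S: "S \<subseteq> I"
    unfolding S_def B_def using y(1) m by auto
  moreover have "x * z \<in> range to_fract" if x: "x \<in> ideal_inverse S" and z: "z \<in> I" for x z
  proof (cases "x = 0 \<or> z = 0")
    case False
    have "0 \<le> v (x * z)" if v: "v \<in> V" for v
    proof -
      have nonneg: "0 \<le> v x + v s" if "s \<in> S" "s \<noteq> 0" for s
        using that x False v integral_iff[of "x * s"] valuation_mult[of v x s]
        by (auto simp: mem_ideal_inverse)
      have "0 \<le> v x + v z"
      proof (cases "v \<in> B")
        case True
        then have "0 \<le> v x + v (m v)"
          using nonneg m[OF v] by (auto simp: S_def)
        moreover have "v (m v) \<le> v z"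
          using m[OF v] z False by auto
        ultimately show ?thesis by linarith
      next
        case notB: False
        then have "v y = 0" "v c = 0"
          using v by (auto simp: B_def)
        moreover have "0 \<le> v c + v z"
          using z False c v integral_iff[of "c * z"] valuation_mult[of v c z] by auto
        ultimately show ?thesis
          using nonneg[of y] y by (auto simp: S_def)
      qed
      then show ?thesis
        using False v by (simp add: valuation_mult)
    qed
    then show ?thesis
      using False by (subst integral_iff) auto
  qed auto
  then have "ideal_inverse S = ideal_inverse I"
    using ideal_inverse_antimono[OF S] by (auto simp: mem_ideal_inverse)
  ultimately show ?thesis
    using y unfolding S_def by blast
qed

lemma t_closure_eq_v_closure:
  assumes "nonzero_fractional_ideal (I :: 'a fract set)"
  shows "t_closure I = v_closure I"
  using finite_subset_same_inverse[OF assms] t_closure_eq_v_closureI[OF assms] by blast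

text \<open>
  If \<open>x I \<subseteq> I\<close> and \<open>y\<close> minimizes \<open>v\<close> on \<open>I\<close>, then \<open>v y \<le> v (x y) = v x + v y\<close>. So \<open>v x\<close> is
  nonnegative for every \<open>v\<close>. This is complete integral closedness, and it makes all ideals invertible.
\<close>
lemma ideal_colon_self:
  assumes I: "nonzero_fractional_ideal (I :: 'a fract set)"
  shows "ideal_colon I I = range to_fract"
proof
  show "range to_fract \<subseteq> ideal_colon I I"
    using I by (auto simp: ideal_colon_def nonzero_fractional_ideal_def
        intro: fract_module.subspace_scale)
  show "ideal_colon I I \<subseteq> range to_fract"
  proof
    fix x assume x: "x \<in> ideal_colon I I"
    show "x \<in> range to_fract"
    proof (cases "x = 0")
      case False
      have "0 \<le> v x" if v: "v \<in> V" for v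
      proof -
        obtain y where y: "y \<in> I" "y \<noteq> 0" "\<forall>z\<in>I. z \<noteq> 0 \<longrightarrow> v y \<le> v z"
          using valuation_attains_minimum[OF I v] by auto
        then have "v y \<le> v (x * y)"
          using x False by (auto simp: ideal_colon_def)
        then show ?thesis
          using y False v by (simp add: valuation_mult)
      qed
      then show ?thesis
        using False by (simp add: integral_iff)
    qed auto
  qed
qed

lemma v_closure_product_inverse:
  assumes "nonzero_fractional_ideal (I :: 'a fract set)"
  shows "v_closure (ideal_product (ideal_inverse I) I) = range to_fract"
proof -
  have "ideal_inverse (ideal_product (ideal_inverse I) I) = range to_fract"
    unfolding ideal_product_commute[of _ I] ideal_inverse_product
    by (intro ideal_colon_self nonzero_fractional_ideal_inverse assms)
  then show ?thesis
    using ideal_inverse_principal[of "1 :: 'a fract"]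
    by (simp add: v_closure_def span_one)
qed

text \<open>
  In a Krull domain the \<open>t\<close>-ideals are the divisorial ideals.
\<close>
lemma fractional_t_ideal_iff:
  "fractional_t_ideal (I :: 'a fract set) \<longleftrightarrow> nonzero_fractional_ideal I \<and> v_closure I = I"
  using t_closure_eq_v_closure unfolding fractional_t_ideal_def nonzero_fractional_ideal_iff
  by auto

abbreviation G :: "'a fract set monoid" where
  "G \<equiv> t_ideal_semigroup TYPE('a)"

lemma carrier_iff: "I \<in> carrier G \<longleftrightarrow> nonzero_fractional_ideal I \<and> v_closure I = I"
  by (simp add: t_ideal_semigroup_def fractional_t_ideal_iff)

lemma mult_eq:
  "I \<in> carrier G \<Longrightarrow> J \<in> carrier G \<Longrightarrow> I \<otimes>\<^bsub>G\<^esub> J = v_closure (ideal_product I J)"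
  unfolding carrier_iff
  by (simp add: t_ideal_semigroup_def t_closure_eq_v_closure nonzero_fractional_ideal_product)

lemma one_eq: "\<one>\<^bsub>G\<^esub> = range to_fract"
  by (simp add: t_ideal_semigroup_def)

lemma v_closure_in_carrier: "nonzero_fractional_ideal I \<Longrightarrow> v_closure I \<in> carrier G"
  unfolding carrier_iff
  by (metis nonzero_fractional_ideal_v_closure ideal_inverse_v_closure v_closure_def)

lemma principal_in_carrier: "c \<noteq> 0 \<Longrightarrow> fract_module.span {c} \<in> carrier G"
  by (simp add: carrier_iff nonzero_fractional_ideal_principal v_closure_principal)

lemma comm_group_t_ideals: "comm_group G"
proof (rule comm_groupI)
  show closed: "I \<otimes>\<^bsub>G\<^esub> J \<in> carrier G" if "I \<in> carrier G" "J \<in> carrier G" for I J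
    unfolding mult_eq[OF that] using that
    by (intro v_closure_in_carrier nonzero_fractional_ideal_product) (auto simp: carrier_iff)
  show "\<one>\<^bsub>G\<^esub> \<in> carrier G"
    using principal_in_carrier[of 1] by (simp add: one_eq span_one)
  show "(I \<otimes>\<^bsub>G\<^esub> J) \<otimes>\<^bsub>G\<^esub> L = I \<otimes>\<^bsub>G\<^esub> (J \<otimes>\<^bsub>G\<^esub> L)"
    if "I \<in> carrier G" "J \<in> carrier G" "L \<in> carrier G" for I J L
    using that closed[of I J] closed[of J L] by (simp add: mult_eq v_closure_product_assoc)
  show "I \<otimes>\<^bsub>G\<^esub> J = J \<otimes>\<^bsub>G\<^esub> I" if "I \<in> carrier G" "J \<in> carrier G" for I J
    using that by (simp add: mult_eq ideal_product_commute)
  show "\<one>\<^bsub>G\<^esub> \<otimes>\<^bsub>G\<^esub> I = I" if "I \<in> carrier G" for I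
    using that \<open>\<one>\<^bsub>G\<^esub> \<in> carrier G\<close>
    by (simp add: mult_eq) (simp add: one_eq carrier_iff v_closure_product_one)
  show "\<exists>J\<in>carrier G. J \<otimes>\<^bsub>G\<^esub> I = \<one>\<^bsub>G\<^esub>" if I: "I \<in> carrier G" for I
  proof (rule bexI)
    show J: "ideal_inverse I \<in> carrier G"
      using I by (auto simp: carrier_iff nonzero_fractional_ideal_inverse v_closure_def)
    show "ideal_inverse I \<otimes>\<^bsub>G\<^esub> I = \<one>\<^bsub>G\<^esub>"
      using I J by (simp add: mult_eq one_eq) (simp add: carrier_iff v_closure_product_inverse)
  qed
qed

lemma subgroup_principal_ideals: "subgroup (principal_ideals TYPE('a)) G"
proof -
  interpret comm_group G by (rule comm_group_t_ideals)
  have mult: "fract_module.span {c} \<otimes>\<^bsub>G\<^esub> fract_module.span {d} = fract_module.span {c * d}"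
    if "c \<noteq> 0" "d \<noteq> 0" for c d
    using that by (simp add: mult_eq principal_in_carrier v_closure_product_principal)
  have inv: "inv\<^bsub>G\<^esub> (fract_module.span {c}) = fract_module.span {inverse c}" if "c \<noteq> 0" for c
    using that by (intro inv_equality) (simp_all add: principal_in_carrier mult one_eq span_one)
  have principalI: "fract_module.span {c} \<in> principal_ideals TYPE('a)" if "c \<noteq> 0" for c
    unfolding principal_ideals_def using that by blast
  show ?thesis
  proof (rule subgroupI)
    show "principal_ideals TYPE('a) \<subseteq> carrier G"
      unfolding principal_ideals_def using principal_in_carrier by blast
    show "principal_ideals TYPE('a) \<noteq> {}"
      using principalI[of 1] by auto
  next
    fix I J assume "I \<in> principal_ideals TYPE('a)" "J \<in> principal_ideals TYPE('a)"
    then obtain c d where "I = fract_module.span {c}" "c \<noteq> 0" "J = fract_module.span {d}" "d \<noteq> 0"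
      unfolding principal_ideals_def by blast
    then show "I \<otimes>\<^bsub>G\<^esub> J \<in> principal_ideals TYPE('a)"
      by (simp add: mult principalI)
  next
    fix I assume "I \<in> principal_ideals TYPE('a)"
    then obtain c where "I = fract_module.span {c}" "c \<noteq> 0"
      unfolding principal_ideals_def by blast
    then show "inv\<^bsub>G\<^esub> I \<in> principal_ideals TYPE('a)"
      by (simp add: inv principalI)
  qed
qed

lemma principal_ideals_normal: "principal_ideals TYPE('a) \<lhd> G"
  using comm_group.subgroup_imp_normal[OF comm_group_t_ideals subgroup_principal_ideals] .

lemma clifford_t_regular: "clifford_t_regular TYPE('a)"
  unfolding clifford_t_regular_def t_class_semigroup_def
  by (intro clifford_group normal.factorgroup_is_group principal_ideals_normal)

lemma boole_t_regular_iff: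
  "boole_t_regular TYPE('a) \<longleftrightarrow>
    (\<forall>I :: 'a fract set. nonzero_fractional_ideal I \<longrightarrow>
      (\<exists>c. c \<noteq> 0 \<and> v_closure I = fract_module.span {c}))"
proof -
  have "boole_t_regular TYPE('a) \<longleftrightarrow> carrier G \<subseteq> principal_ideals TYPE('a)"
    unfolding boole_t_regular_def t_class_semigroup_def
    by (rule boolean_quotient_iff[OF principal_ideals_normal])
  also have "\<dots> \<longleftrightarrow> (\<forall>I :: 'a fract set. nonzero_fractional_ideal I \<longrightarrow>
      (\<exists>c. c \<noteq> 0 \<and> v_closure I = fract_module.span {c}))"
    unfolding principal_ideals_def using v_closure_in_carrier
    by (auto simp: subset_iff carrier_iff) metis+
  finally show ?thesis .
qed

end

section \<open>Factorial domains\<close>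

text \<open>
  Primality is spelled out by divisibility so that the rule transfers easily from the class \<open>ufd\<close> to its
  underlying predicate.
\<close>
lemma (in ufd) prime_factor_induct:
  assumes "x \<noteq> 0"
    and unit: "\<And>u. u dvd 1 \<Longrightarrow> P u"
    and step: "\<And>p b. p \<noteq> 0 \<Longrightarrow> \<not> p dvd 1 \<Longrightarrow> (\<And>a c. p dvd a * c \<Longrightarrow> p dvd a \<or> p dvd c) \<Longrightarrow>
      b \<noteq> 0 \<Longrightarrow> P b \<Longrightarrow> P (p * b)"
  shows "P x"
proof -
  have *: "P (prod_mset F)" if "\<And>f. f \<in># F \<Longrightarrow> prime_elem f" for F
    using that
  proof (induction F)
    case empty
    then show ?case by (simp add: unit)
  next
    case (add f F)
    then have f: "prime_elem f" and F: "\<And>g. g \<in># F \<Longrightarrow> prime_elem g"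
      by auto
    have "prod_mset F \<noteq> 0"
      using F by (auto simp: prime_elem_def)
    then have "P (f * prod_mset F)"
      using f[unfolded prime_elem_def] add.IH[OF F] by (intro step) auto
    then show ?case by simp
  qed
  show ?thesis
  proof (cases "x dvd 1")
    case False
    with \<open>x \<noteq> 0\<close> obtain F where "mset_factors F x"
      using mset_factors_exist by blast
    then have "prod_mset F = x" "\<And>f. f \<in># F \<Longrightarrow> prime_elem f"
      by (auto simp: mset_factors_def)
    with * show ?thesis by blast
  qed (rule unit)
qed

lemma factorial_ring_induct [consumes 2, case_names unit prime]:
  fixes x :: "'a :: idom"
  assumes "factorial_ring TYPE('a)" and "x \<noteq> 0"
    and unit: "\<And>u. u dvd 1 \<Longrightarrow> P u"
    and step: "\<And>p b. prime_elem p \<Longrightarrow> b \<noteq> 0 \<Longrightarrow> P b \<Longrightarrow> P (p * b)"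
  shows "P x"
proof (rule ufd.prime_factor_induct[OF assms(1)[unfolded factorial_ring_def], unfolded dvd_rewrites])
  show "P (p * b)" if "p \<noteq> 0" "\<not> p dvd 1" "\<And>a c. p dvd a * c \<Longrightarrow> p dvd a \<or> p dvd c"
    "b \<noteq> 0" "P b" for p b
    using that by (intro step) (auto simp: prime_elem_def)
qed (use assms in auto)

lemma prime_elem_not_dvd_unit: "prime_elem p \<Longrightarrow> u dvd 1 \<Longrightarrow> \<not> p dvd u"
  by (meson dvd_trans prime_elem_not_unit)

lemma prime_elem_dvd_prime_elem:
  fixes p q :: "'a :: idom"
  assumes "prime_elem p" "prime_elem q" "p dvd q"
  obtains u where "u dvd 1" "q = p * u"
proof -
  from assms(3) obtain u where u: "q = p * u" by blast
  have "u dvd 1"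
    using irreducibleD[OF prime_elem_imp_irreducible[OF assms(2)] u] prime_elem_not_unit[OF assms(1)] by blast
  with u that show thesis by blast
qed

lemma prime_elem_not_dvd_mult:
  "prime_elem p \<Longrightarrow> \<not> p dvd a \<Longrightarrow> \<not> p dvd b \<Longrightarrow> \<not> p dvd a * b"
  by (simp add: prime_elem_dvd_mult_iff)

text \<open>
  A maximal common divisor of a set that contains \<open>z \<noteq> 0\<close>, by induction on the prime factors of \<open>z\<close>.
  For \<open>z = q b\<close> let \<open>c\<close> be such a divisor for \<open>S\<close> together with \<open>b\<close>. If \<open>c\<close> is not yet maximal for \<open>S\<close>, then
  \<open>c p\<close> divides \<open>S\<close> for a prime \<open>p\<close>, and this prime must be associated to \<open>q\<close>. Then \<open>c p\<close> is maximal: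
  a further prime \<open>r\<close> would make \<open>c r\<close> a common divisor of \<open>S\<close> and \<open>b\<close>.
\<close>
lemma factorial_ring_set_gcd:
  fixes z :: "'a :: idom"
  assumes R: "factorial_ring TYPE('a)" and "z \<noteq> 0" and "z \<in> S"
  shows "\<exists>c. c \<noteq> 0 \<and> (\<forall>s\<in>S. c dvd s) \<and> (\<forall>p. prime_elem p \<longrightarrow> (\<exists>s\<in>S. \<not> c * p dvd s))"
  using assms
proof (induction z arbitrary: S rule: factorial_ring_induct)
  case (unit u)
  have "\<not> p dvd u" if "prime_elem p" for p
    by (rule prime_elem_not_dvd_unit[OF that unit.hyps])
  with unit.prems show ?case
    by (intro exI[of _ 1] conjI ballI allI impI bexI[of _ u]) simp_all
next
  case (prime q b)
  obtain c where "c \<noteq> 0 \<and> (\<forall>s\<in>insert b S. c dvd s) \<and>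
      (\<forall>p. prime_elem p \<longrightarrow> (\<exists>s\<in>insert b S. \<not> c * p dvd s))"
    using prime.IH[OF insertI1[of b S]] ..
  then have c: "c \<noteq> 0" "\<forall>s\<in>insert b S. c dvd s"
    and primitive: "\<And>p. prime_elem p \<Longrightarrow> \<exists>s\<in>insert b S. \<not> c * p dvd s"
    by simp_all
  show ?case
  proof (cases "\<exists>p. prime_elem p \<and> (\<forall>s\<in>S. c * p dvd s)")
    case False
    have "\<forall>s\<in>S. c dvd s"
      using c(2) by simp
    moreover have "\<exists>s\<in>S. \<not> c * p dvd s" if "prime_elem p" for p
      using False that by simp
    ultimately show ?thesis
      using c(1) by (intro exI[of _ c] conjI) simp_all
  next
    case True
    then obtain p where "prime_elem p \<and> (\<forall>s\<in>S. c * p dvd s)" ..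
    then have p: "prime_elem p" and cp: "\<And>s. s \<in> S \<Longrightarrow> c * p dvd s"
      by simp_all
    obtain b' where b': "b = c * b'"
      using bspec[OF c(2) insertI1] by (rule dvdE)
    have "\<not> p dvd b'"
      using primitive[OF p] cp c(1) b' by simp
    moreover have "p dvd q * b'"
      using cp[OF prime.prems] c(1) by (simp add: b' mult.left_commute)
    ultimately have "p dvd q"
      by (simp add: prime_elem_dvd_mult_iff[OF p])
    then obtain u where u: "u dvd 1" "q = p * u"
      using prime_elem_dvd_prime_elem[OF p prime.hyps(1)] by metis
    have "\<exists>s\<in>S. \<not> c * p * r dvd s" if r: "prime_elem r" for r
    proof (rule ccontr)
      assume "\<not> (\<exists>s\<in>S. \<not> c * p * r dvd s)"
      then have *: "c * p * r dvd s" if "s \<in> S" for s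
        using that by simp
      then have "c * p * r dvd c * p * (u * b')"
        using prime.prems by (simp add: b' u mult_ac)
      then have "r dvd u * b'"
        using c(1) prime_elem_not_zeroI[OF p] by simp
      moreover have "\<not> r dvd u"
        by (rule prime_elem_not_dvd_unit[OF r u(1)])
      ultimately have "r dvd b'"
        by (simp add: prime_elem_dvd_mult_iff[OF r])
      then have "c * r dvd b"
        by (simp add: b')
      moreover have "c * r dvd s" if "s \<in> S" for s
        using *[OF that] by (auto simp: mult.assoc mult.left_commute[of c p] intro: dvd_mult_right)
      ultimately show False
        using primitive[OF r] by simp
    qed
    with cp c(1) prime_elem_not_zeroI[OF p] show ?thesis
      by (intro exI[of _ "c * p"] conjI) simp_all
  qed
qed

text \<open>
  A prime in the denominator of \<open>w\<close> would have to divide every element of \<open>T\<close>. The induction removes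
  the primes of the denominator one at a time.
\<close>
lemma primitive_integral:
  fixes w :: "'a :: idom fract"
  assumes R: "factorial_ring TYPE('a)"
    and primitive: "\<And>p. prime_elem p \<Longrightarrow> \<exists>t\<in>T. \<not> p dvd t"
    and w: "\<And>t. t \<in> T \<Longrightarrow> w * to_fract t \<in> range to_fract"
  shows "w \<in> range to_fract"
proof -
  obtain a b where ab: "b \<noteq> 0" "w * to_fract b = to_fract a"
    by (rule fract_denominator)
  then have "w * to_fract b \<in> range to_fract"
    by simp
  with R \<open>b \<noteq> 0\<close> show ?thesis
    using w
  proof (induction b arbitrary: w rule: factorial_ring_induct)
    case (unit u)
    from unit.hyps obtain u' where "1 = u * u'" by blast
    then have "w = (w * to_fract u) * to_fract u'"
      by (simp add: mult.assoc flip: to_fract_mult)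
    with unit.prems(1) show ?case
      using range_to_fract_mult by (metis rangeI)
  next
    case (prime q b)
    have "w * to_fract q \<in> range to_fract"
    proof (rule prime.IH)
      show "w * to_fract q * to_fract b \<in> range to_fract"
        using prime.prems(1) by (simp add: mult.assoc)
      show "w * to_fract q * to_fract t \<in> range to_fract" if "t \<in> T" for t
      proof -
        have "w * to_fract t * to_fract q \<in> range to_fract"
          by (rule range_to_fract_mult[OF prime.prems(2)[OF that] rangeI])
        then show ?thesis by (simp add: mult_ac)
      qed
    qed
    then obtain a where a: "w * to_fract q = to_fract a" by blast
    obtain t where t: "t \<in> T" "\<not> q dvd t"
      using primitive[OF prime.hyps(1)] by blast
    obtain r where r: "w * to_fract t = to_fract r"
      using prime.prems(2)[OF t(1)] by blast
    have "to_fract (a * t) = to_fract (q * r)"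
      by (simp flip: a r add: mult_ac)
    then have "a * t = q * r"
      by (simp only: to_fract_eq_iff)
    then have "q dvd a * t"
      by simp
    then obtain a' where a': "a = q * a'"
      using t(2) by (auto simp: prime_elem_dvd_mult_iff[OF prime.hyps(1)])
    have "w * to_fract q = to_fract a' * to_fract q"
      using a by (simp add: a' mult.commute)
    then have "w = to_fract a'"
      using prime.hyps(1) by simp
    then show ?case by simp
  qed
qed

text \<open>
  With a denominator \<open>d\<close> of \<open>I\<close> and a greatest common divisor \<open>c\<close> of \<open>d I \<subseteq> R\<close>, the set \<open>T = d I / c\<close> is
  primitive, so its inverse is \<open>R\<close>. Hence the inverse of \<open>I\<close> is generated by \<open>d / c\<close>.
\<close>
lemma factorial_ring_v_closure_principal:
  fixes I :: "'a :: idom fract set"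
  assumes R: "factorial_ring TYPE('a)" and I: "nonzero_fractional_ideal I"
  shows "\<exists>c. c \<noteq> 0 \<and> v_closure I = fract_module.span {c}"
proof -
  from I obtain x d where x: "x \<in> I" "x \<noteq> 0"
    and d_inverse: "d \<in> ideal_inverse I" "d \<noteq> 0"
    unfolding nonzero_fractional_ideal_def by blast
  then have d: "\<And>y. y \<in> I \<Longrightarrow> d * y \<in> range to_fract" "d \<noteq> 0"
    by (simp_all add: mem_ideal_inverse)
  define S where "S = {s. \<exists>y\<in>I. d * y = to_fract s}"
  obtain z where z: "d * x = to_fract z"
    using d(1)[OF x(1)] by blast
  have "z \<in> S"
    using x z by (auto simp: S_def)
  moreover have "z \<noteq> 0"
    using x(2) d(2) z by auto
  ultimately have "\<exists>c. c \<noteq> 0 \<and> (\<forall>s\<in>S. c dvd s) \<and> (\<forall>p. prime_elem p \<longrightarrow> (\<exists>s\<in>S. \<not> c * p dvd s))"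
    by (intro factorial_ring_set_gcd[OF R])
  then obtain c where "c \<noteq> 0 \<and> (\<forall>s\<in>S. c dvd s) \<and>
      (\<forall>p. prime_elem p \<longrightarrow> (\<exists>s\<in>S. \<not> c * p dvd s))" ..
  then have c: "c \<noteq> 0" "\<And>s. s \<in> S \<Longrightarrow> c dvd s"
    and primitive: "\<And>p. prime_elem p \<Longrightarrow> \<exists>s\<in>S. \<not> c * p dvd s"
    by simp_all
  define T where "T = {t. c * t \<in> S}"
  have T_primitive: "\<exists>t\<in>T. \<not> p dvd t" if p: "prime_elem p" for p
  proof -
    obtain s where s: "s \<in> S" "\<not> c * p dvd s"
      using bexE[OF primitive[OF p]] .
    obtain t where "s = c * t"
      using c(2)[OF s(1)] by (rule dvdE)
    with s show ?thesis
      using c(1) by (intro bexI[of _ t]) (simp_all add: T_def)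
  qed
  define e where "e = d / to_fract c"
  have e: "e \<noteq> 0" "d = e * to_fract c"
    using c(1) d(2) by (auto simp: e_def)
  have "ideal_inverse I = fract_module.span {e}"
  proof
    show "fract_module.span {e} \<subseteq> ideal_inverse I"
    proof (intro fract_module.span_minimal subspace_ideal_inverse)
      have "e * y \<in> range to_fract" if y: "y \<in> I" for y
      proof -
        obtain s where s: "d * y = to_fract s"
          using d(1)[OF y] by blast
        with y have "s \<in> S"
          by (auto simp: S_def)
        then obtain t where t: "s = c * t"
          using c(2) dvdE by metis
        have "to_fract c * (e * y) = to_fract c * to_fract t"
          using s by (simp add: e(2) t mult_ac)
        then show ?thesis
          using c(1) by simp
      qed
      then show "{e} \<subseteq> ideal_inverse I"
        by (simp add: mem_ideal_inverse)
    qed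
    show "ideal_inverse I \<subseteq> fract_module.span {e}"
    proof
      fix y assume y: "y \<in> ideal_inverse I"
      define w where "w = y / e"
      have w: "y = w * e"
        using e(1) by (simp add: w_def)
      have integral: "w * to_fract t \<in> range to_fract" if t: "t \<in> T" for t
      proof -
        obtain x' where x': "x' \<in> I" "d * x' = to_fract (c * t)"
          using t by (auto simp: T_def S_def)
        have "to_fract c * (e * x') = to_fract c * to_fract t"
          using x'(2) by (simp add: e(2) mult_ac)
        then have "e * x' = to_fract t"
          using c(1) by simp
        then have "w * to_fract t = y * x'"
          by (simp add: w mult.assoc)
        with y x'(1) show ?thesis
          by (simp add: mem_ideal_inverse)
      qed
      have "w \<in> range to_fract"
        by (rule primitive_integral[OF R T_primitive integral])
      then show "y \<in> fract_module.span {e}"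
        by (auto simp: w span_singleton_eq)
    qed
  qed
  then have "v_closure I = fract_module.span {inverse e}"
    by (simp add: v_closure_def ideal_inverse_principal e(1))
  with e(1) show ?thesis
    by (intro exI[of _ "inverse e"]) simp
qed

section \<open>Prime valuations of a factorial domain\<close>

text \<open>
  The relation \<open>v\<^sub>p x = k\<close>, in the form \<open>x = p\<^sup>m a / (p\<^sup>n b)\<close> with \<open>a\<close> and \<open>b\<close> prime to \<open>p\<close> and \<open>k = m - n\<close>.
  Two exponents, rather than one integer exponent, keep the equation between elements of \<open>R\<close>.
\<close>
definition adic_value :: "'a :: idom \<Rightarrow> 'a fract \<Rightarrow> int \<Rightarrow> bool" where
  "adic_value p x k \<longleftrightarrow>
     (\<exists>m n a b. k = int m - int n \<and> \<not> p dvd a \<and> \<not> p dvd b \<and>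
       x * to_fract (p ^ n * b) = to_fract (p ^ m * a))"

text \<open>
  If \<open>p\<close> is prime then no \<open>k\<close> qualifies at \<open>x = 0\<close>. There the value does not depend on \<open>p\<close>, so associated primes yield equal
  functions (\<open>adic_valuation_associated\<close>) and each valuation occurs only once in the Krull family.
\<close>
definition adic_valuation :: "'a :: idom \<Rightarrow> 'a fract \<Rightarrow> int" where
  "adic_valuation p x = (THE k. adic_value p x k)"

lemma adic_valueI:
  "\<not> p dvd a \<Longrightarrow> \<not> p dvd b \<Longrightarrow> x * to_fract (p ^ n * b) = to_fract (p ^ m * a) \<Longrightarrow>
    k = int m - int n \<Longrightarrow> adic_value p x k"
  unfolding adic_value_def by blast

lemma adic_valueE:
  assumes "adic_value p x k"
  obtains m n a b where "k = int m - int n" "\<not> p dvd a" "\<not> p dvd b"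
    "x * to_fract (p ^ n * b) = to_fract (p ^ m * a)"
  using assms unfolding adic_value_def by blast

lemma prime_power_exponent_le:
  fixes p :: "'a :: idom"
  assumes "prime_elem p" "\<not> p dvd d" "p ^ i * c = p ^ j * d"
  shows "i \<le> j"
proof (rule ccontr)
  assume "\<not> i \<le> j"
  then obtain l where l: "i = j + Suc l"
    using less_imp_Suc_add[of j i] by auto
  have "p ^ j * (p * (p ^ l * c)) = p ^ j * d"
    using assms(3) by (simp add: l power_add mult.assoc)
  then have "p * (p ^ l * c) = d"
    using prime_elem_not_zeroI[OF assms(1)] by simp
  then have "p dvd d"
    by (metis dvd_triv_left)
  with assms(2) show False ..
qed

lemma adic_value_unique:
  fixes p :: "'a :: idom"
  assumes p: "prime_elem p" and kl: "adic_value p x k" "adic_value p x l"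
  shows "k = l"
proof -
  obtain m n a b where 1: "k = int m - int n" "\<not> p dvd a" "\<not> p dvd b"
    "x * to_fract (p ^ n * b) = to_fract (p ^ m * a)"
    using kl(1) by (rule adic_valueE)
  obtain m' n' a' b' where 2: "l = int m' - int n'" "\<not> p dvd a'" "\<not> p dvd b'"
    "x * to_fract (p ^ n' * b') = to_fract (p ^ m' * a')"
    using kl(2) by (rule adic_valueE)
  have "to_fract (p ^ (m + n') * (a * b')) = to_fract (p ^ m * a) * to_fract (p ^ n' * b')"
    by (simp add: power_add mult_ac)
  also have "\<dots> = to_fract (p ^ m' * a') * to_fract (p ^ n * b)"
    unfolding 1(4)[symmetric] 2(4)[symmetric] by (simp only: mult_ac)
  also have "\<dots> = to_fract (p ^ (m' + n) * (a' * b))"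
    by (simp add: power_add mult_ac)
  finally have eq: "p ^ (m + n') * (a * b') = p ^ (m' + n) * (a' * b)"
    by (simp only: to_fract_eq_iff)
  have "m + n' \<le> m' + n"
    using prime_elem_not_dvd_mult[OF p 2(2) 1(3)] eq by (rule prime_power_exponent_le[OF p])
  moreover have "m' + n \<le> m + n'"
    using prime_elem_not_dvd_mult[OF p 1(2) 2(3)] eq[symmetric] by (rule prime_power_exponent_le[OF p])
  ultimately show ?thesis
    using 1(1) 2(1) by simp
qed

lemma adic_valuation_eq:
  assumes "prime_elem p" "adic_value p x k"
  shows "adic_valuation p x = k"
  unfolding adic_valuation_def using assms adic_value_unique by (intro the_equality)

lemma adic_value_mult:
  fixes p :: "'a :: idom"
  assumes p: "prime_elem p" and kl: "adic_value p x k" "adic_value p y l"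
  shows "adic_value p (x * y) (k + l)"
proof -
  obtain m n a b where 1: "k = int m - int n" "\<not> p dvd a" "\<not> p dvd b"
    "x * to_fract (p ^ n * b) = to_fract (p ^ m * a)"
    using kl(1) by (rule adic_valueE)
  obtain m' n' a' b' where 2: "l = int m' - int n'" "\<not> p dvd a'" "\<not> p dvd b'"
    "y * to_fract (p ^ n' * b') = to_fract (p ^ m' * a')"
    using kl(2) by (rule adic_valueE)
  have "x * y * to_fract (p ^ (n + n') * (b * b')) =
        (x * to_fract (p ^ n * b)) * (y * to_fract (p ^ n' * b'))"
    by (simp add: power_add mult_ac)
  also have "\<dots> = to_fract (p ^ (m + m') * (a * a'))"
    unfolding 1(4) 2(4) by (simp add: power_add mult_ac)
  finally show ?thesis
    using 1 2 prime_elem_not_dvd_mult[OF p]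
    by (intro adic_valueI[of p "a * a'" "b * b'" _ "n + n'" "m + m'"]) simp_all
qed

lemma prime_power_cofactor:
  fixes p :: "'a :: idom"
  assumes R: "factorial_ring TYPE('a)" and p: "prime_elem p" and "z \<noteq> 0"
  shows "\<exists>m a. \<not> p dvd a \<and> z = p ^ m * a"
  using R \<open>z \<noteq> 0\<close>
proof (induction z rule: factorial_ring_induct)
  case (unit u)
  then show ?case
    using prime_elem_not_dvd_unit[OF p] by (intro exI[of _ 0] exI[of _ u]) simp
next
  case (prime q b)
  then obtain m a where a: "\<not> p dvd a" "b = p ^ m * a"
    by metis
  show ?case
  proof (cases "p dvd q")
    case True
    then obtain u where u: "u dvd 1" "q = p * u"
      by (rule prime_elem_dvd_prime_elem[OF p prime.hyps(1)])
    have "\<not> p dvd u * a"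
      using prime_elem_not_dvd_mult[OF p prime_elem_not_dvd_unit[OF p u(1)] a(1)] .
    then show ?thesis
      by (intro exI[of _ "Suc m"] exI[of _ "u * a"]) (simp add: a(2) u(2) mult_ac)
  next
    case False
    then have "\<not> p dvd q * a"
      using prime_elem_not_dvd_mult[OF p _ a(1)] by simp
    then show ?thesis
      by (intro exI[of _ m] exI[of _ "q * a"]) (simp add: a(2) mult_ac)
  qed
qed

lemma adic_value_exists:
  fixes x :: "'a :: idom fract"
  assumes R: "factorial_ring TYPE('a)" and p: "prime_elem p" and "x \<noteq> 0"
  shows "\<exists>k. adic_value p x k"
proof -
  obtain a b where ab: "b \<noteq> 0" "x * to_fract b = to_fract a"
    by (rule fract_denominator)
  then have "a \<noteq> 0"
    using \<open>x \<noteq> 0\<close> by auto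
  then obtain m a' n b' where "\<not> p dvd a'" "a = p ^ m * a'" "\<not> p dvd b'" "b = p ^ n * b'"
    using prime_power_cofactor[OF R p] ab(1) by metis
  with ab(2) show ?thesis
    by (intro exI[of _ "int m - int n"] adic_valueI[of p a' b' x n m]) simp_all
qed

text \<open>
  Over a common denominator the sum is \<open>p\<^sup>k\<close> times a fraction whose denominator is prime to \<open>p\<close>; its
  numerator \<open>e\<close> can only contribute a further nonnegative power of \<open>p\<close>.
\<close>
lemma adic_value_add_ge:
  fixes p :: "'a :: idom"
  assumes R: "factorial_ring TYPE('a)" and p: "prime_elem p"
    and kl: "adic_value p x k" "adic_value p y l" and "k \<le> l" and "x + y \<noteq> 0"
  shows "\<exists>j\<ge>k. adic_value p (x + y) j"
proof -
  obtain m n a b where 1: "k = int m - int n" "\<not> p dvd a" "\<not> p dvd b"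
    "x * to_fract (p ^ n * b) = to_fract (p ^ m * a)"
    using kl(1) by (rule adic_valueE)
  obtain m' n' a' b' where 2: "l = int m' - int n'" "\<not> p dvd a'" "\<not> p dvd b'"
    "y * to_fract (p ^ n' * b') = to_fract (p ^ m' * a')"
    using kl(2) by (rule adic_valueE)
  have "m + n' \<le> m' + n"
    using \<open>k \<le> l\<close> 1(1) 2(1) by simp
  then obtain i where i: "m' + n = m + n' + i"
    using le_Suc_ex by blast
  define e where "e = a * b' + p ^ i * (a' * b)"
  have "(x + y) * to_fract (p ^ (n + n') * (b * b')) =
        (x * to_fract (p ^ n * b)) * to_fract (p ^ n' * b') +
        (y * to_fract (p ^ n' * b')) * to_fract (p ^ n * b)"
    by (simp add: power_add algebra_simps)
  also have "\<dots> = to_fract (p ^ (m + n') * (a * b') + p ^ (m' + n) * (a' * b))"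
    unfolding 1(4) 2(4) by (simp add: power_add algebra_simps)
  also have "p ^ (m + n') * (a * b') + p ^ (m' + n) * (a' * b) = p ^ (m + n') * e"
    unfolding i e_def by (simp add: power_add algebra_simps)
  finally have sum: "(x + y) * to_fract (p ^ (n + n') * (b * b')) = to_fract (p ^ (m + n') * e)" .
  have bb': "\<not> p dvd b * b'"
    using prime_elem_not_dvd_mult[OF p 1(3) 2(3)] .
  have "p \<noteq> 0" "b * b' \<noteq> 0"
    using prime_elem_not_zeroI[OF p] bb' by auto
  then have "e \<noteq> 0"
    using sum \<open>x + y \<noteq> 0\<close> by auto
  then obtain s f where f: "\<not> p dvd f" "e = p ^ s * f"
    using prime_power_cofactor[OF R p] by metis
  have "adic_value p (x + y) (k + int s)"
    using f(1) bb' sum 1(1)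
    by (intro adic_valueI[of p f "b * b'" _ "n + n'" "m + n' + s"])
      (simp_all add: f(2) power_add mult.assoc)
  then show ?thesis
    by (intro exI[of _ "k + int s"]) simp
qed

lemma adic_value_associated:
  fixes p q :: "'a :: idom"
  assumes q: "prime_elem q" and u: "p = q * u" "u * w = 1" and k: "adic_value p x k"
  shows "adic_value q x k"
proof -
  obtain m n a b where 1: "k = int m - int n" "\<not> p dvd a" "\<not> p dvd b"
    "x * to_fract (p ^ n * b) = to_fract (p ^ m * a)"
    using k by (rule adic_valueE)
  have *: "\<not> q dvd u ^ i * c" if "\<not> p dvd c" for i c
  proof
    assume "q dvd u ^ i * c"
    moreover have "\<not> q dvd u ^ i"
    proof (rule prime_elem_not_dvd_unit[OF q])
      have "u ^ i * w ^ i = 1"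
        using u(2) by (simp flip: power_mult_distrib)
      then show "u ^ i dvd 1"
        by (metis dvd_triv_left)
    qed
    ultimately have "q dvd c"
      by (simp add: prime_elem_dvd_mult_iff[OF q])
    then obtain c' where "c = q * c'" ..
    then have "c = p * (w * c')"
      using u by (metis mult.assoc mult.left_neutral mult.right_neutral)
    with that show False
      by simp
  qed
  show ?thesis
    using 1 by (intro adic_valueI[OF *[OF 1(2), of m] *[OF 1(3), of n]])
      (simp_all add: u(1) power_mult_distrib mult.assoc)
qed

lemma adic_valuation_associated:
  fixes p q :: "'a :: idom"
  assumes p: "prime_elem p" and q: "prime_elem q" and "p dvd q"
  shows "adic_valuation p = adic_valuation q"
proof -
  obtain u where u: "u dvd 1" "q = p * u"
    using prime_elem_dvd_prime_elem[OF assms] .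
  then obtain w where w: "1 = u * w"
    by (elim dvdE)
  have "p = q * w"
    using u w by (simp add: mult.assoc)
  have "adic_value p x k \<longleftrightarrow> adic_value q x k" for x k
    using adic_value_associated[OF p u(2) w[symmetric]]
      adic_value_associated[OF q \<open>p = q * w\<close>, of u] w by (metis mult.commute)
  then show ?thesis
    unfolding adic_valuation_def by (intro ext arg_cong[of _ _ The])
qed

lemma adic_value_not_dvd:
  assumes "prime_elem p" "\<not> p dvd a"
  shows "adic_value p (to_fract a) 0"
  using assms by (intro adic_valueI[of p a 1 _ 0 0]) (auto dest: prime_elem_not_unit)

lemma adic_valuation_integral_nonneg:
  fixes p :: "'a :: idom"
  assumes R: "factorial_ring TYPE('a)" and p: "prime_elem p" and "z \<noteq> 0"
  shows "0 \<le> adic_valuation p (to_fract z)"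
proof -
  obtain m a where "\<not> p dvd a" "z = p ^ m * a"
    using prime_power_cofactor[OF R p \<open>z \<noteq> 0\<close>] by metis
  then have "adic_value p (to_fract z) (int m)"
    using prime_elem_not_unit[OF p] by (intro adic_valueI[of p a 1 _ 0 m]) simp_all
  then show ?thesis
    using adic_valuation_eq[OF p] by simp
qed

lemma adic_value_power:
  assumes "prime_elem p"
  shows "adic_value p (to_fract (p ^ m) / to_fract (p ^ n)) (int m - int n)"
  using assms
  by (intro adic_valueI[of p 1 1 _ n m]) (auto dest: prime_elem_not_unit prime_elem_not_zeroI)

lemma discrete_adic_valuation:
  fixes p :: "'a :: idom"
  assumes R: "factorial_ring TYPE('a)" and p: "prime_elem p"
  shows "discrete_valuation (adic_valuation p)"
proof -
  note eq = adic_valuation_eq[OF p]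
  have valued: "adic_value p x (adic_valuation p x)" if "x \<noteq> 0" for x
    using adic_value_exists[OF R p that] eq by metis
  have mult: "adic_valuation p (x * y) = adic_valuation p x + adic_valuation p y"
    if "x \<noteq> 0" "y \<noteq> 0" for x y
    by (intro eq adic_value_mult[OF p] valued that)
  have add: "adic_valuation p x \<le> adic_valuation p (x + y)"
    if "x \<noteq> 0" "y \<noteq> 0" "x + y \<noteq> 0" "adic_valuation p x \<le> adic_valuation p y" for x y
    using adic_value_add_ge[OF R p valued[OF that(1)] valued[OF that(2)] that(4,3)] eq by metis
  have min: "min (adic_valuation p x) (adic_valuation p y) \<le> adic_valuation p (x + y)"
    if "x \<noteq> 0" "y \<noteq> 0" "x + y \<noteq> 0" for x y
    using add[of x y] add[of y x] that by (cases "adic_valuation p x \<le> adic_valuation p y")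
      (simp_all add: add.commute)
  have surj: "k \<in> adic_valuation p ` (UNIV - {0})" for k
  proof -
    define x where "x = to_fract (p ^ nat k) / to_fract (p ^ nat (- k))"
    have "adic_valuation p x = k"
      unfolding x_def by (subst eq[OF adic_value_power[OF p]]) simp
    moreover have "x \<noteq> 0"
      using prime_elem_not_zeroI[OF p] by (simp add: x_def)
    ultimately show ?thesis
      by (metis DiffI UNIV_I image_eqI singletonD)
  qed
  show ?thesis
    unfolding discrete_valuation_def using mult min surj by (simp add: set_eq_iff)
qed

text \<open>
  Finite character is about valuations and not about primes: \<open>z\<close> may have infinitely many associated
  prime divisors, but these define the same valuation.
\<close>
lemma finite_adic_valuations_dvd:
  fixes z :: "'a :: idom"
  assumes R: "factorial_ring TYPE('a)" and "z \<noteq> 0"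
  shows "finite (adic_valuation ` {p. prime_elem p \<and> p dvd z})"
  using assms
proof (induction z rule: factorial_ring_induct)
  case (unit u)
  then have "prime_elem p \<Longrightarrow> \<not> p dvd u" for p
    using prime_elem_not_dvd_unit by metis
  then have empty: "{p. prime_elem p \<and> p dvd u} = {}"
    by auto
  show ?case
    unfolding empty by simp
next
  case (prime q b)
  have "adic_valuation p \<in> insert (adic_valuation q) (adic_valuation ` {p. prime_elem p \<and> p dvd b})"
    if "prime_elem p" "p dvd q * b" for p
    using that adic_valuation_associated[OF that(1) prime.hyps(1)]
    by (auto simp: prime_elem_dvd_mult_iff)
  then have "adic_valuation ` {p. prime_elem p \<and> p dvd q * b} \<subseteq>
      insert (adic_valuation q) (adic_valuation ` {p. prime_elem p \<and> p dvd b})"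
    by (intro image_subsetI) simp
  then show ?case
    using prime.IH by (rule finite_subset[OF _ finite.insertI])
qed

text \<open>
  By induction on the denominator. For a denominator \<open>q b\<close> the induction hypothesis makes \<open>x q\<close>
  integral; its \<open>q\<close>-value is at least \<open>1\<close>, so \<open>q\<close> divides it and \<open>x\<close> is integral as well.
\<close>
lemma integral_if_adic_valuations_nonneg:
  fixes x :: "'a :: idom fract"
  assumes R: "factorial_ring TYPE('a)" and "x \<noteq> 0"
    and "\<And>p. prime_elem p \<Longrightarrow> 0 \<le> adic_valuation p x"
  shows "x \<in> range to_fract"
proof -
  obtain a b where ab: "b \<noteq> 0" "x * to_fract b = to_fract a"
    by (rule fract_denominator)
  then have "x * to_fract b \<in> range to_fract"
    by simp
  with R \<open>b \<noteq> 0\<close> show ?thesis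
    using assms(2,3)
  proof (induction b arbitrary: x rule: factorial_ring_induct)
    case (unit u)
    then obtain w where w: "1 = u * w"
      by (elim dvdE)
    have "(x * to_fract u) * to_fract w = x * to_fract (u * w)"
      by (simp add: mult.assoc)
    also have "\<dots> = x"
      by (simp flip: w)
    finally have "x * to_fract u * to_fract w = x" .
    with range_to_fract_mult[OF unit.prems(1) rangeI[of to_fract w]] show ?case
      by (simp only:)
  next
    case (prime q b)
    have q: "q \<noteq> 0"
      using prime_elem_not_zeroI[OF prime.hyps(1)] .
    have valued: "adic_value p y (adic_valuation p y)"
      if "prime_elem p" "y \<noteq> 0" for p :: 'a and y
      using adic_value_exists[OF R that] adic_valuation_eq[OF that(1)] by metis
    have mult: "adic_valuation p (x * to_fract q) = adic_valuation p x + adic_valuation p (to_fract q)"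
      if p: "prime_elem p" for p
      using q prime.prems(2) by (intro adic_valuation_eq[OF p] adic_value_mult[OF p] valued[OF p]) simp_all
    have nonneg: "0 \<le> adic_valuation p (x * to_fract q)" if p: "prime_elem p" for p
      using mult[OF p] prime.prems(3)[OF p] adic_valuation_integral_nonneg[OF R p q] by simp
    have "x * to_fract q * to_fract b \<in> range to_fract"
      using prime.prems(1) by (simp add: mult.assoc)
    moreover have "x * to_fract q \<noteq> 0"
      using q prime.prems(2) by simp
    ultimately have "x * to_fract q \<in> range to_fract"
      by (rule prime.IH) (rule nonneg)
    then obtain a where a: "x * to_fract q = to_fract a"
      by blast
    have "adic_valuation q (to_fract q) = 1"
      using adic_value_power[OF prime.hyps(1), of 1 0] adic_valuation_eq[OF prime.hyps(1)] by simp
    then have "adic_valuation q (to_fract a) \<noteq> 0"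
      using mult[OF prime.hyps(1)] prime.prems(3)[OF prime.hyps(1)] a by simp
    then have "q dvd a"
      using adic_value_not_dvd[OF prime.hyps(1)] adic_valuation_eq[OF prime.hyps(1)] by metis
    then obtain a' where "a = q * a'" ..
    then have "x = to_fract a'"
      using a q by simp
    then show ?case by simp
  qed
qed

lemma krull_domain_if_factorial_ring:
  assumes R: "factorial_ring TYPE('a :: idom)"
  shows "krull_domain TYPE('a)"
  unfolding krull_domain_def
proof (intro exI conjI ballI allI impI)
  let ?V = "adic_valuation ` {p :: 'a. prime_elem p}"
  show "discrete_valuation v" if "v \<in> ?V" for v
    using that discrete_adic_valuation[OF R] by auto
  show "range to_fract = {x. x = 0 \<or> (\<forall>v\<in>?V. 0 \<le> v x)}"
  proof (intro equalityI subsetI)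
    fix x :: "'a fract" assume "x \<in> range to_fract"
    then obtain a where "x = to_fract a" ..
    then show "x \<in> {x. x = 0 \<or> (\<forall>v\<in>?V. 0 \<le> v x)}"
      using adic_valuation_integral_nonneg[OF R, of _ a] by (cases "a = 0") simp_all
  next
    fix x :: "'a fract" assume "x \<in> {x. x = 0 \<or> (\<forall>v\<in>?V. 0 \<le> v x)}"
    then show "x \<in> range to_fract"
      using integral_if_adic_valuations_nonneg[OF R, of x] by (cases "x = 0") simp_all
  qed
  fix x :: "'a fract" assume "x \<noteq> 0"
  obtain a b where ab: "b \<noteq> 0" "x * to_fract b = to_fract a"
    by (rule fract_denominator)
  then have "a \<noteq> 0"
    using \<open>x \<noteq> 0\<close> by auto
  have support: "adic_valuation p \<in> adic_valuation ` {p. prime_elem p \<and> p dvd a} \<union>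
      adic_valuation ` {p. prime_elem p \<and> p dvd b}"
    if p: "prime_elem p" "adic_valuation p x \<noteq> 0" for p
  proof (rule ccontr)
    assume "\<not> ?thesis"
    then have "\<not> p dvd a" "\<not> p dvd b"
      using p(1) by auto
    then have "adic_value p x 0"
      using ab(2) by (intro adic_valueI[of p a b x 0 0]) simp_all
    with p show False
      using adic_valuation_eq by metis
  qed
  have "{v \<in> ?V. v x \<noteq> 0} \<subseteq> adic_valuation ` {p. prime_elem p \<and> p dvd a} \<union>
      adic_valuation ` {p. prime_elem p \<and> p dvd b}"
  proof
    fix v assume "v \<in> {v \<in> ?V. v x \<noteq> 0}"
    then obtain p where "v = adic_valuation p" "prime_elem p" "v x \<noteq> 0"
      by auto
    then show "v \<in> adic_valuation ` {p. prime_elem p \<and> p dvd a} \<union>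
        adic_valuation ` {p. prime_elem p \<and> p dvd b}"
      using support[of p] by simp
  qed
  then show "finite {v \<in> ?V. v x \<noteq> 0}"
    using finite_adic_valuations_dvd[OF R] ab(1) \<open>a \<noteq> 0\<close> by (meson finite_Un finite_subset)
qed

section \<open>Krull domains with only principal divisorial ideals\<close>

lemma prime_elem_dvd_prod_mset:
  fixes p :: "'a :: idom"
  assumes p: "prime_elem p"
  shows "p dvd prod_mset G \<Longrightarrow> \<exists>g. g \<in># G \<and> p dvd g"
proof (induction G)
  case empty
  with prime_elem_not_unit[OF p] show ?case by simp
next
  case (add g G)
  then show ?case
    by (simp add: prime_elem_dvd_mult_iff[OF p]) metis
qed

text \<open>
  Stated for products that are associated rather than equal, because cancelling a pair of associated
  factors leaves products that differ by a unit.
\<close>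
lemma irreducible_factors_unique:
  fixes F G :: "'a :: idom multiset"
  assumes prime: "\<And>p :: 'a. irreducible p \<Longrightarrow> prime_elem p"
    and "\<And>f. f \<in># F \<Longrightarrow> irreducible f" "\<And>g. g \<in># G \<Longrightarrow> irreducible g"
    and "prod_mset F dvd prod_mset G" "prod_mset G dvd prod_mset F"
  shows "rel_mset (\<lambda>x y. x dvd y \<and> y dvd x) F G"
  using assms(2-)
proof (induction F arbitrary: G)
  case empty
  have "G = {#}"
  proof (rule ccontr)
    assume "G \<noteq> {#}"
    then obtain g where g: "g \<in># G"
      by blast
    have "g dvd 1"
      using dvd_trans[OF dvd_prod_mset[OF g] empty(4)] by simp
    with empty(2)[OF g] show False
      by (simp add: irreducible_def)
  qed
  then show ?case
    by (simp add: rel_mset_Zero)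
next
  case (add f F)
  have f: "prime_elem f"
    using prime add.prems(1) by simp
  have "f dvd prod_mset G"
    using add.prems(3) by (auto intro: dvd_mult_left)
  then obtain g where g: "g \<in># G" "f dvd g"
    using prime_elem_dvd_prod_mset[OF f] by metis
  obtain u where u: "u dvd 1" "g = f * u"
    using prime_elem_dvd_prime_elem[OF f prime[OF add.prems(2)[OF g(1)]] g(2)] .
  obtain w where w: "1 = u * w"
    using u(1) by (elim dvdE)
  have f_eq: "f = g * w"
    using u(2) w by (simp add: mult.assoc)
  obtain G' where G: "G = add_mset g G'"
    using g(1) by (metis multi_member_split)
  have f0: "f \<noteq> 0"
    using prime_elem_not_zeroI[OF f] .
  have "f * prod_mset F dvd f * (u * prod_mset G')"
    using add.prems(3) by (simp add: G u(2) mult.assoc)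
  then have "prod_mset F dvd u * prod_mset G'"
    using f0 by simp
  then have "prod_mset F dvd w * (u * prod_mset G')"
    by simp
  also have "w * (u * prod_mset G') = prod_mset G'"
    using w by (metis mult.assoc mult.commute mult.left_neutral)
  finally have FG: "prod_mset F dvd prod_mset G'" .
  have "f * (u * prod_mset G') dvd f * prod_mset F"
    using add.prems(4) by (simp add: G u(2) mult.assoc)
  then have GF: "prod_mset G' dvd prod_mset F"
    using f0 by (auto intro: dvd_mult_right)
  have "rel_mset (\<lambda>x y. x dvd y \<and> y dvd x) F G'"
    using add.prems(1,2) FG GF by (intro add.IH) (simp_all add: G)
  moreover have "f dvd g \<and> g dvd f"
    using u(2) f_eq by (metis dvd_triv_left)
  ultimately show ?case
    unfolding G by (intro rel_mset_Plus)
qed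

lemma (in idom) class_ufdI:
  assumes "\<And>x. x \<noteq> 0 \<Longrightarrow> \<not> x dvd 1 \<Longrightarrow> \<exists>F. mset_factors F x"
    and "\<And>x F G. mset_factors F x \<Longrightarrow> mset_factors G x \<Longrightarrow> rel_mset (ddvd) F G"
  shows "class.ufd ((*) :: 'a \<Rightarrow> _) 1 (+) 0 (-) uminus"
  by unfold_locales (use assms in blast)+

lemma factorial_ringI:
  assumes atomic: "\<And>x :: 'a :: idom. x \<noteq> 0 \<Longrightarrow> \<not> x dvd 1 \<Longrightarrow> \<exists>F. mset_factors F x"
    and prime: "\<And>p :: 'a. irreducible p \<Longrightarrow> prime_elem p"
  shows "factorial_ring TYPE('a)"
  unfolding factorial_ring_def
proof (rule class_ufdI)
  show "rel_mset (\<lambda>x y. x dvd y \<and> y dvd x) F G" if "mset_factors F x" "mset_factors G x"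
    for F G and x :: 'a
    using that by (intro irreducible_factors_unique[OF prime]) (auto simp: mset_factors_def)
qed (rule atomic)

context krull_valuations
begin

text \<open>
  The sum of all valuations is additive and positive on nonunits, so it decreases strictly when an
  element is split into two nonunits.
\<close>
definition total_value :: "'a fract \<Rightarrow> int" where
  "total_value x = (\<Sum>v\<in>{v \<in> V. v x \<noteq> 0}. v x)"

lemma total_value_eq:
  assumes "finite S" "{v \<in> V. v x \<noteq> 0} \<subseteq> S" "S \<subseteq> V"
  shows "total_value x = (\<Sum>v\<in>S. v x)"
  unfolding total_value_def using assms by (intro sum.mono_neutral_left) auto

lemma total_value_mult:
  assumes "x \<noteq> 0" "y \<noteq> 0"
  shows "total_value (x * y) = total_value x + total_value y"
proof -
  define S where "S = {v \<in> V. v x \<noteq> 0} \<union> {v \<in> V. v y \<noteq> 0}"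
  have S: "finite S" "S \<subseteq> V"
    unfolding S_def using finite_character assms by auto
  have "total_value (x * y) = (\<Sum>v\<in>S. v (x * y))"
    using S by (intro total_value_eq) (auto simp: S_def valuation_mult assms)
  also have "\<dots> = (\<Sum>v\<in>S. v x + v y)"
    using S(2) assms by (intro sum.cong refl) (auto simp: valuation_mult)
  also have "\<dots> = total_value x + total_value y"
    using S total_value_eq[of S x] total_value_eq[of S y] by (simp add: sum.distrib S_def)
  finally show ?thesis .
qed

lemma total_value_pos:
  assumes "a \<noteq> 0" "\<not> a dvd 1"
  shows "0 < total_value (to_fract a)"
proof -
  let ?x = "to_fract a"
  have x: "?x \<noteq> 0"
    using assms by simp
  have nonneg: "0 \<le> v ?x" if "v \<in> V" for v
    using that integral_iff[OF x] by auto
  have "\<exists>v\<in>V. v ?x \<noteq> 0"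
  proof (rule ccontr)
    assume "\<not> ?thesis"
    then have zero: "v ?x = 0" if "v \<in> V" for v
      using that by simp
    have "v (inverse ?x) = 0" if v: "v \<in> V" for v
    proof -
      have "v 1 = v 1 + v 1"
        using valuation_mult[OF v, of 1 1] by simp
      moreover have "v (?x * inverse ?x) = v ?x + v (inverse ?x)"
        using x by (intro valuation_mult[OF v]) simp_all
      ultimately show ?thesis
        using zero[OF v] x by simp
    qed
    then have "\<forall>v\<in>V. 0 \<le> v (inverse ?x)"
      by (metis order_refl)
    then have "inverse ?x \<in> range to_fract"
      using x by (simp only: integral_iff nonzero_imp_inverse_nonzero not_False_eq_True)
    then obtain b where b: "inverse ?x = to_fract b" ..
    have "to_fract (a * b) = ?x * inverse ?x"
      by (simp add: b)
    also have "\<dots> = to_fract 1"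
      using x by simp
    finally have "a * b = 1"
      by (simp only: to_fract_eq_iff)
    with assms(2) show False
      by (metis dvd_triv_left)
  qed
  then obtain v where v: "v \<in> {v \<in> V. v ?x \<noteq> 0}"
    by auto
  show ?thesis
    unfolding total_value_def
  proof (rule sum_pos2[OF finite_character[OF x] v])
    show "0 < v ?x"
      using v nonneg[of v] by simp
  qed (use nonneg in simp)
qed

lemma irreducible_factorization_exists:
  fixes a :: 'a
  assumes "a \<noteq> 0" "\<not> a dvd 1"
  shows "\<exists>F. mset_factors F a"
  using assms
proof (induction "nat (total_value (to_fract a))" arbitrary: a rule: less_induct)
  case less
  show ?case
  proof (cases "irreducible a")
    case True
    then have "mset_factors {#a#} a"
      by (intro mset_factorsI) simp_all
    then show ?thesis ..
  next
    case False
    then obtain b c where bc: "a = b * c" "\<not> b dvd 1" "\<not> c dvd 1"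
      using less.prems unfolding irreducible_def by metis
    have nz: "b \<noteq> 0" "c \<noteq> 0"
      using less.prems(1) bc(1) by auto
    have "total_value (to_fract a) = total_value (to_fract b) + total_value (to_fract c)"
      using nz by (simp add: bc(1) total_value_mult)
    then have "nat (total_value (to_fract b)) < nat (total_value (to_fract a))"
      "nat (total_value (to_fract c)) < nat (total_value (to_fract a))"
      using total_value_pos[OF nz(1) bc(2)] total_value_pos[OF nz(2) bc(3)] by simp_all
    then obtain F H where "mset_factors F b" "mset_factors H c"
      using less.hyps nz bc(2,3) by metis
    then show ?thesis
      using mset_factors_mult[of F b H c] unfolding bc(1) by metis
  qed
qed

end

text \<open>
  Let \<open>p\<close> divide \<open>a b\<close> but not \<open>b\<close>, and let the closure of \<open>I = (p, b)\<close> be generated by \<open>d\<close>. Then \<open>d\<close> is a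
  common divisor of \<open>p\<close> and \<open>b\<close>, hence a unit, and \<open>1\<close> lies in the closure of \<open>I\<close>. As \<open>a / p\<close> multiplies
  both \<open>p\<close> and \<open>b\<close> into \<open>R\<close>, it lies in the inverse of \<open>I\<close>; so \<open>a / p = 1 * (a / p)\<close> is integral.
\<close>
lemma irreducible_imp_prime_elem_if_v_closure_principal:
  fixes p :: "'a :: idom"
  assumes principal: "\<And>I :: 'a fract set. nonzero_fractional_ideal I \<Longrightarrow>
      \<exists>c. c \<noteq> 0 \<and> v_closure I = fract_module.span {c}"
    and p: "irreducible p"
  shows "prime_elem p"
proof (rule prime_elemI)
  show p0: "p \<noteq> 0" and "\<not> p dvd 1"
    using p by (simp_all add: irreducible_def)
  fix a b assume pab: "p dvd a * b"
  show "p dvd a \<or> p dvd b"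
  proof (rule disjCI)
    assume pb: "\<not> p dvd b"
    define I where "I = fract_module.span {to_fract p, to_fract b}"
    have gens: "to_fract p \<in> I" "to_fract b \<in> I"
      unfolding I_def by (simp_all add: fract_module.span_base)
    have inverse_iff: "y \<in> ideal_inverse I \<longleftrightarrow>
        y * to_fract p \<in> range to_fract \<and> y * to_fract b \<in> range to_fract" for y
      unfolding I_def ideal_inverse_span by (simp add: mem_ideal_inverse)
    have "1 \<in> ideal_inverse I"
      by (simp add: inverse_iff)
    then have "nonzero_fractional_ideal I"
      unfolding nonzero_fractional_ideal_def using gens p0
      by (intro conjI bexI[of _ "to_fract p"] bexI[of _ 1]) (simp_all add: I_def)
    then obtain c where c: "v_closure I = fract_module.span {c}"
      using principal by metis
    have "c \<in> v_closure I"
      unfolding c by (simp add: fract_module.span_base)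
    then have "c * 1 \<in> range to_fract"
      using \<open>1 \<in> ideal_inverse I\<close> by (rule v_closure_times_inverse)
    then obtain d where d: "c = to_fract d"
      by auto
    have dvd: "d dvd s" if "to_fract s \<in> I" for s
    proof -
      have "to_fract s \<in> fract_module.span {c}"
        using that subset_v_closure c by blast
      then obtain r where "to_fract s = to_fract r * to_fract d"
        by (auto simp: span_singleton_eq d)
      then have "s = r * d"
        by (simp only: to_fract_eq_iff flip: to_fract_mult)
      then show ?thesis by simp
    qed
    obtain e where e: "p = d * e"
      using dvd[OF gens(1)] ..
    have "\<not> e dvd 1"
    proof
      assume "e dvd 1"
      then obtain e' where "1 = e * e'" ..
      then have "d = p * e'"
        using e by (simp add: mult.assoc)
      then have "p dvd d"
        by simp
      with pb dvd[OF gens(2)] show False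
        by (metis dvd_trans)
    qed
    then have "d dvd 1"
      using irreducibleD[OF p e] by simp
    then obtain d' where "1 = d * d'" ..
    then have "1 = to_fract d' * c"
      unfolding d by (metis mult.commute to_fract_1 to_fract_mult)
    then have one: "1 \<in> v_closure I"
      unfolding c span_singleton_eq by (rule range_eqI)
    obtain r where r: "a * b = p * r"
      using pab ..
    define y where "y = to_fract a / to_fract p"
    have "y * to_fract b = to_fract (a * b) / to_fract p"
      by (simp add: y_def)
    also have "\<dots> = to_fract r"
      using p0 by (simp add: r)
    finally have "y \<in> ideal_inverse I"
      using p0 by (simp add: inverse_iff y_def)
    then have "1 * y \<in> range to_fract"
      by (rule v_closure_times_inverse[OF one])
    then obtain s where "y = to_fract s"
      by auto
    then have "to_fract a = to_fract (p * s)"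
      using p0 by (simp add: y_def field_simps)
    then have "a = p * s"
      by (simp only: to_fract_eq_iff)
    then show "p dvd a"
      by simp
  qed
qed

theorem proposition2p2:
  shows "(krull_domain TYPE('a :: idom) \<longrightarrow> clifford_t_regular TYPE('a)) \<and>
    (factorial_ring TYPE('a) \<longleftrightarrow> krull_domain TYPE('a) \<and> boole_t_regular TYPE('a))"
proof (intro conjI impI iffI)
  assume "krull_domain TYPE('a)"
  then obtain V :: "('a fract \<Rightarrow> int) set" where "krull_valuations V"
    unfolding krull_domain_iff ..
  then show "clifford_t_regular TYPE('a)"
    by (rule krull_valuations.clifford_t_regular)
next
  assume R: "factorial_ring TYPE('a)"
  then show "krull_domain TYPE('a)"
    by (rule krull_domain_if_factorial_ring)
  then obtain V :: "('a fract \<Rightarrow> int) set" where "krull_valuations V"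
    unfolding krull_domain_iff ..
  then show "boole_t_regular TYPE('a)"
    using factorial_ring_v_closure_principal[OF R]
    by (simp add: krull_valuations.boole_t_regular_iff)
next
  assume *: "krull_domain TYPE('a) \<and> boole_t_regular TYPE('a)"
  then obtain V :: "('a fract \<Rightarrow> int) set" where V: "krull_valuations V"
    unfolding krull_domain_iff by metis
  have principal: "\<exists>c. c \<noteq> 0 \<and> v_closure I = fract_module.span {c}"
    if "nonzero_fractional_ideal I" for I :: "'a fract set"
    using * that krull_valuations.boole_t_regular_iff[OF V] by simp
  show "factorial_ring TYPE('a)"
    by (intro factorial_ringI krull_valuations.irreducible_factorization_exists[OF V]
        irreducible_imp_prime_elem_if_v_closure_principal principal)
qed

end
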